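(* Let $1\le p<\infty$ and let $X$, $Y$ be Banach spaces. (i) Suppose $X^*$ has the $p$-Gelfand-Phillips ($p$-GP) property and $Y$ has the Schur property. If $M$ is a closed subspace of $L(X,Y)$, then $M$ has the $p$-GP property. (ii) Suppose $X$ has the $p$-GP property and $Y$ has the Schur property. Then $L_{w^*}(X^*,Y)=K_{w^*}(X^*,Y)$, and every closed subspace $M$ of $L_{w^*}(X^*,Y)=K_{w^*}(X^*,Y)$ has the $p$-GP property. (iii) Suppose $Y$ has the $p$-GP property and $X$ has the Schur property. Then $L_{w^*}(X^*,Y)=K_{w^*}(X^*,Y)$, and every closed subspace $M$ of $L_{w^*}(X^*,Y)=K_{w^*}(X^*,Y)$ has the $p$-GP property.
   Context: Operators are continuous linear maps, with the operator norm. $L(X,Y)$ is the space of all operators from $X$ to $Y$; $L_{w^*}(X^*,Y)$ is the space of $w^*$-$w$ continuous operators from $X^*$ to $Y$, and $K_{w^*}(X^*,Y)$ is its subspace of compact operators. A bounded subset $A$ of a Banach space $E$ is limited if every $w^*$-null sequence $(e_n^* )$ in $E^*$ satisfies $\sup_{x\in A}|e_n^*(x)|\to 0$. A sequence is limited if its set of terms is limited. A sequence $(x_n)$ in $E$ is weakly $p$-summable if $(x^*(x_n))_n\in\ell_p$ for every $x^*\in E^*$. $E$ has the $p$-Gelfand-Phillips ($p$-GP) property if every limited weakly $p$-summable sequence in $E$ (i.e. both limited and weakly $p$-summable) is norm null. $E$ has the Schur property if every weakly convergent sequence in $E$ is norm convergent. *)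

theory Defs
  imports "HOL-Analysis.Analysis"
begin

text \<open>
  Banach spaces are real. A closed subspace of a Banach space is itself a Banach space, but as a
  set rather than as a type, so the notions below that are needed for subspaces are relativised
  to a carrier set \<open>E\<close>. The dual of \<open>E\<close> is intrinsic: its elements need only be defined, linear
  and bounded on \<open>E\<close> (a weak-star null sequence in \<open>E\<^sup>*\<close> need not extend to a
  weak-star null sequence of functionals on the ambient space).
\<close>

definition functional_on :: "'a::real_normed_vector set \<Rightarrow> ('a \<Rightarrow> real) \<Rightarrow> bool" where
  "functional_on E f \<longleftrightarrow>
     (\<forall>x\<in>E. \<forall>y\<in>E. f (x + y) = f x + f y) \<and>
     (\<forall>c. \<forall>x\<in>E. f (c *\<^sub>R x) = c * f x) \<and>
     (\<exists>K. \<forall>x\<in>E. \<bar>f x\<bar> \<le> K * norm x)"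

lemma functional_on_UNIV: "functional_on UNIV f \<longleftrightarrow> bounded_linear f"
  by (auto simp: functional_on_def bounded_linear_def bounded_linear_axioms_def linear_iff mult.commute)

definition weakstar_null_on :: "'a::real_normed_vector set \<Rightarrow> (nat \<Rightarrow> 'a \<Rightarrow> real) \<Rightarrow> bool" where
  "weakstar_null_on E f \<longleftrightarrow> (\<forall>n. functional_on E (f n)) \<and> (\<forall>x\<in>E. (\<lambda>n. f n x) \<longlonglongrightarrow> 0)"

text \<open>The supremum is taken in \<^typ>\<open>ennreal\<close> so that it is meaningful without side conditions.\<close>

definition limited_on :: "'a::real_normed_vector set \<Rightarrow> 'a set \<Rightarrow> bool" where
  "limited_on E A \<longleftrightarrow> A \<subseteq> E \<and> bounded A \<and>
     (\<forall>f. weakstar_null_on E f \<longrightarrow> (\<lambda>n. SUP x\<in>A. ennreal \<bar>f n x\<bar>) \<longlonglongrightarrow> 0)"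

definition weakly_p_summable_on ::
    "real \<Rightarrow> 'a::real_normed_vector set \<Rightarrow> (nat \<Rightarrow> 'a) \<Rightarrow> bool" where
  "weakly_p_summable_on p E x \<longleftrightarrow> range x \<subseteq> E \<and>
     (\<forall>f. functional_on E f \<longrightarrow> summable (\<lambda>n. \<bar>f (x n)\<bar> powr p))"

definition p_Gelfand_Phillips_on :: "real \<Rightarrow> 'a::real_normed_vector set \<Rightarrow> bool" where
  "p_Gelfand_Phillips_on p E \<longleftrightarrow>
     (\<forall>x. limited_on E (range x) \<and> weakly_p_summable_on p E x \<longrightarrow> x \<longlonglongrightarrow> 0)"

definition weak_topology :: "'a::real_normed_vector topology" where
  "weak_topology =
     pullback_topology UNIV (\<lambda>x (f :: 'a \<Rightarrow>\<^sub>L real). blinfun_apply f x) euclidean"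

lemma limitin_weak_topology:
  "limitin weak_topology x (l::'a::real_normed_vector) F \<longleftrightarrow>
     (\<forall>f :: 'a \<Rightarrow>\<^sub>L real. ((\<lambda>n. blinfun_apply f (x n)) \<longlongrightarrow> blinfun_apply f l) F)"
proof -
  let ?e = "\<lambda>y (f :: 'a \<Rightarrow>\<^sub>L real). blinfun_apply f y"
  have "limitin weak_topology x l F \<longleftrightarrow> ((\<lambda>n. ?e (x n)) \<longlongrightarrow> ?e l) F"
    unfolding limitin_def weak_topology_def openin_pullback_topology topspace_pullback_topology
      tendsto_def
    by auto
  also have "\<dots> \<longleftrightarrow> limitin (product_topology (\<lambda>_. euclidean) UNIV) (\<lambda>n. ?e (x n)) (?e l) F"
    by (simp add: euclidean_product_topology)
  also have "\<dots> \<longleftrightarrow> (\<forall>f. ((\<lambda>n. ?e (x n) f) \<longlongrightarrow> ?e l f) F)"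
    by (subst limitin_componentwise) auto
  finally show ?thesis .
qed

definition Schur_property :: "'a::real_normed_vector itself \<Rightarrow> bool" where
  "Schur_property _ \<longleftrightarrow>
     (\<forall>x :: nat \<Rightarrow> 'a. (\<exists>l. limitin weak_topology x l sequentially) \<longrightarrow> convergent x)"

text \<open>
  For real-valued operators \<^const>\<open>strong_operator_topology\<close> is the topology of pointwise
  convergence on the dual space, i.e. the weak-star topology.
\<close>

abbreviation weakstar_topology :: "('a::real_normed_vector \<Rightarrow>\<^sub>L real) topology" where
  "weakstar_topology \<equiv> strong_operator_topology"

definition L_wstar :: "(('a::real_normed_vector \<Rightarrow>\<^sub>L real) \<Rightarrow>\<^sub>L 'b::real_normed_vector) set" where
  "L_wstar = {T. continuous_map weakstar_topology weak_topology (blinfun_apply T)}"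

definition compact_operator ::
    "('a::real_normed_vector \<Rightarrow>\<^sub>L 'b::real_normed_vector) \<Rightarrow> bool" where
  "compact_operator T \<longleftrightarrow> compact (closure (blinfun_apply T ` cball 0 1))"

definition K_wstar :: "(('a::real_normed_vector \<Rightarrow>\<^sub>L real) \<Rightarrow>\<^sub>L 'b::real_normed_vector) set" where
  "K_wstar = {T \<in> L_wstar. compact_operator T}"

end

theory Submission
  imports Defs
begin

text \<open>
  Let \<open>T\<^sub>n\<close> be a limited weakly \<open>p\<close>-summable sequence in \<open>M\<close>. Bounded linear maps from \<open>M\<close> preserve
  both properties, so if the factor with the \<open>p\<close>-Gelfand-Phillips property is \<open>X\<^sup>*\<close> or \<open>X\<close> then
  \<open>T\<^sub>n\<^sup>* g\<close> is norm null for every \<open>g\<close> in \<open>Y\<^sup>*\<close>. Hence \<open>T\<^sub>n x\<^sub>n\<close> is weakly null for every bounded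
  sequence \<open>x\<^sub>n\<close>, and norm null by the Schur property of \<open>Y\<close>; choosing \<open>x\<^sub>n\<close> almost norming for \<open>T\<^sub>n\<close>
  gives \<open>T\<^sub>n \<longlonglongrightarrow> 0\<close>. In (iii) the same argument is applied to the adjoints \<open>Y\<^sup>* \<rightarrow> X\<close>, which exist because
  weak-star continuous functionals on \<open>X\<^sup>*\<close> are evaluations at points of \<open>X\<close>.

  For \<open>L\<^sub>w\<^sub>* = K\<^sub>w\<^sub>*\<close> only the Schur property matters: by Alaoglu's theorem the image of the dual ball is
  relatively weakly compact, an Eberlein-Smulian argument yields weakly convergent subsequences, and
  these converge in norm; if \<open>X\<close> is the Schur space, this is applied to the adjoint and followed by
  Schauder's theorem. The Hahn-Banach theorem comes from the fact that minimal sublinear functionals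
  are linear.
\<close>

section \<open>The Hahn-Banach theorem\<close>

text \<open>Only an inequality is required of scaling, since infima inherit it directly; applying it
  to the inverse scalar recovers equality in \<open>sublinear_scale\<close>.\<close>

definition sublinear :: "('a::real_vector \<Rightarrow> real) \<Rightarrow> bool" where
  "sublinear q \<longleftrightarrow> (\<forall>x y. q (x + y) \<le> q x + q y) \<and> (\<forall>c>0. \<forall>x. q (c *\<^sub>R x) \<le> c * q x)"

lemma sublinear_add: "sublinear q \<Longrightarrow> q (x + y) \<le> q x + q y"
  by (simp add: sublinear_def)

lemma sublinear_scale_le: "sublinear q \<Longrightarrow> c > 0 \<Longrightarrow> q (c *\<^sub>R x) \<le> c * q x"
  by (simp add: sublinear_def)

lemma sublinear_zero: "sublinear q \<Longrightarrow> q 0 = 0"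
  using sublinear_scale_le[of q 2 0] sublinear_scale_le[of q "1/2" 0] by simp

lemma sublinear_minus: "sublinear q \<Longrightarrow> - q (- x) \<le> q x"
  using sublinear_add[of q x "- x"] sublinear_zero[of q] by simp

lemma sublinear_scale:
  assumes "sublinear q" "c \<ge> 0"
  shows "q (c *\<^sub>R x) = c * q x"
proof (cases "c = 0")
  case False
  then have c: "c > 0" using assms by simp
  have "q x \<le> inverse c * q (c *\<^sub>R x)"
    using sublinear_scale_le[OF assms(1), of "inverse c" "c *\<^sub>R x"] c by simp
  then have "c * q x \<le> q (c *\<^sub>R x)" using c by (simp add: field_simps)
  then show ?thesis using sublinear_scale_le[OF assms(1) c, of x] by simp
qed (simp add: sublinear_zero assms)

text \<open>The witness is the infimum of \<open>q (x + t y) - t q y\<close> over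
  \<open>t \<ge> 0\<close>: \<open>t = 0\<close> gives domination by \<open>q\<close>, and
  \<open>t = 1\<close> at \<open>- y\<close> gives \<open>- q y\<close>. Hence minimal sublinear
  functionals are odd.\<close>

lemma sublinear_decrease:
  assumes q: "sublinear q"
  shows "\<exists>p. sublinear p \<and> (\<forall>x. p x \<le> q x) \<and> p (- y) \<le> - q y"
proof -
  define g where "g x t = q (x + t *\<^sub>R y) - t * q y" for x t
  define p where "p x = (INF t\<in>{0..}. g x t)" for x
  have bdd: "bdd_below (g x ` {0..})" for x
  proof (rule bdd_belowI2)
    fix t :: real assume "t \<in> {0..}"
    then have "t * q y = q ((x + t *\<^sub>R y) + (- x))" using sublinear_scale[OF q] by simp
    also have "\<dots> \<le> q (x + t *\<^sub>R y) + q (- x)" by (rule sublinear_add[OF q])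
    finally show "- q (- x) \<le> g x t" by (simp add: g_def)
  qed
  have le: "p x \<le> g x t" if "t \<ge> 0" for x t
    unfolding p_def using bdd that by (auto intro: cINF_lower)
  have ge: "b \<le> p x" if "\<And>t. t \<ge> 0 \<Longrightarrow> b \<le> g x t" for b x
    unfolding p_def using that by (auto intro!: cINF_greatest)
  have add: "p (x + x') \<le> p x + p x'" for x x'
  proof -
    have "p (x + x') \<le> g x s + g x' t" if "s \<ge> 0" "t \<ge> 0" for s t
    proof -
      have "p (x + x') \<le> g (x + x') (s + t)" using le that by simp
      also have "\<dots> \<le> g x s + g x' t"
        using sublinear_add[OF q, of "x + s *\<^sub>R y" "x' + t *\<^sub>R y"]
        by (simp add: g_def algebra_simps)
      finally show ?thesis .
    qed
    then have "p (x + x') - g x s \<le> p x'" if "s \<ge> 0" for s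
      using that by (intro ge) (simp add: algebra_simps)
    then have "p (x + x') - p x' \<le> p x"
      by (intro ge) (simp add: algebra_simps)
    then show ?thesis by simp
  qed
  have scale: "p (c *\<^sub>R x) \<le> c * p x" if "c > 0" for c x
  proof -
    have "p (c *\<^sub>R x) / c \<le> p x"
    proof (rule ge)
      fix t :: real assume t: "t \<ge> 0"
      have "p (c *\<^sub>R x) \<le> g (c *\<^sub>R x) (c * t)" using le that t by simp
      also have "\<dots> = c * g x t"
        using sublinear_scale[OF q, of c "x + t *\<^sub>R y"] that
        by (simp add: g_def algebra_simps)
      finally show "p (c *\<^sub>R x) / c \<le> g x t" using that by (simp add: field_simps)
    qed
    then show ?thesis using that by (simp add: field_simps)
  qed
  have "p x \<le> q x" for x using le[of 0 x] by (simp add: g_def)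
  moreover have "p (- y) \<le> - q y"
    using le[of 1 "- y"] by (simp add: g_def sublinear_zero[OF q])
  moreover have "sublinear p" using add scale by (simp add: sublinear_def)
  ultimately show ?thesis by blast
qed

lemma minimal_sublinear_linear:
  assumes q: "sublinear q"
    and min: "\<And>p. sublinear p \<Longrightarrow> (\<And>x. p x \<le> q x) \<Longrightarrow> p = q"
  shows "linear q"
proof -
  have minus: "q (- y) = - q y" for y
  proof -
    obtain p where "sublinear p" "\<And>x. p x \<le> q x" "p (- y) \<le> - q y"
      using sublinear_decrease[OF q, of y] by blast
    with min have "q (- y) \<le> - q y" by blast
    then show ?thesis using sublinear_minus[OF q, of y] by simp
  qed
  show ?thesis
  proof (rule linearI)
    fix x y
    have "q x \<le> q (x + y) + q (- y)"
      using sublinear_add[OF q, of "x + y" "- y"] by simp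
    then show "q (x + y) = q x + q y"
      using sublinear_add[OF q, of x y] minus[of y] by simp
  next
    fix c x
    show "q (c *\<^sub>R x) = c *\<^sub>R q x"
    proof (cases "c \<ge> 0")
      case False
      then show ?thesis
        using sublinear_scale[OF q, of "- c" x] minus[of "c *\<^sub>R x"] by simp
    qed (simp add: sublinear_scale[OF q])
  qed
qed

text \<open>The common bound \<open>q\<close> makes \<open>- q (- x)\<close> a lower bound for every
  member, so the infimum is finite. For subadditivity, two members are replaced by the smaller one,
  which the chain provides.\<close>

lemma sublinear_INF_chain:
  assumes "C \<noteq> {}"
    and sub: "\<And>p. p \<in> C \<Longrightarrow> sublinear p"
    and bound: "\<And>p x. p \<in> C \<Longrightarrow> p x \<le> q x"
    and chain: "\<And>p p'. p \<in> C \<Longrightarrow> p' \<in> C \<Longrightarrow> p \<le> p' \<or> p' \<le> p"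
  defines "m \<equiv> \<lambda>x. INF p\<in>C. p x"
  shows "sublinear m" and "p \<in> C \<Longrightarrow> m x \<le> p x"
proof -
  have "- q (- x) \<le> p x" if "p \<in> C" for p x
    using sublinear_minus[OF sub[OF that], of x] bound[OF that, of "- x"] by linarith
  then have bdd: "bdd_below ((\<lambda>p. p x) ` C)" for x
    by (rule bdd_belowI2)
  have le: "m x \<le> p x" if "p \<in> C" for p x
    unfolding m_def using bdd that by (rule cINF_lower)
  have ge: "b \<le> m x" if "\<And>p. p \<in> C \<Longrightarrow> b \<le> p x" for b x
    unfolding m_def using that \<open>C \<noteq> {}\<close> by (intro cINF_greatest)
  show "m x \<le> p x" if "p \<in> C" using le that .
  have add: "m (x + y) \<le> m x + m y" for x y
  proof -
    have "m (x + y) \<le> p x + p' y" if p: "p \<in> C" "p' \<in> C" for p p'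
    proof -
      obtain r where r: "r \<in> C" "r \<le> p" "r \<le> p'" using chain[OF p] p by blast
      have "m (x + y) \<le> r x + r y"
        using le[OF r(1), of "x + y"] sublinear_add[OF sub[OF r(1)], of x y] by simp
      also have "\<dots> \<le> p x + p' y" using r by (auto simp: le_fun_def intro: add_mono)
      finally show ?thesis .
    qed
    then have "m (x + y) - p x \<le> m y" if "p \<in> C" for p
      using that by (intro ge) (simp add: diff_le_eq add.commute[of _ "p x"])
    then have "m (x + y) - m y \<le> m x" by (intro ge) (simp add: algebra_simps)
    then show ?thesis by simp
  qed
  have scale: "m (c *\<^sub>R x) \<le> c * m x" if "c > 0" for c x
  proof -
    have "m (c *\<^sub>R x) / c \<le> m x"
    proof (rule ge)
      fix p assume p: "p \<in> C"
      show "m (c *\<^sub>R x) / c \<le> p x"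
        using le[OF p, of "c *\<^sub>R x"] sublinear_scale_le[OF sub[OF p] that, of x] that
        by (simp add: field_simps)
    qed
    then show ?thesis using that by (simp add: field_simps)
  qed
  show "sublinear m" using add scale by (simp add: sublinear_def)
qed

text \<open>First \<open>q\<close> is decreased until the value at \<open>- z\<close> is at most
  \<open>- q z\<close>. A minimal sublinear functional below the result is linear, so oddness turns
  this bound into \<open>f z \<ge> q z\<close>.\<close>

theorem Hahn_Banach_sublinear:
  assumes q: "sublinear q"
  obtains f where "linear f" "\<And>x. f x \<le> q x" "f z = q z"
proof -
  obtain q' where q': "sublinear q'" "\<And>x. q' x \<le> q x" "q' (- z) \<le> - q z"
    using sublinear_decrease[OF q, of z] by blast
  define A where "A = {p. sublinear p \<and> p \<le> q'}"
  have "\<exists>m\<in>A. \<forall>p\<in>A. p \<le> m \<longrightarrow> p = m"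
  proof -
    have "\<exists>m\<in>A. \<forall>p\<in>A. m \<ge> p \<longrightarrow> p = m"
    proof (rule predicate_Zorn)
      show "partial_order_on A (relation_of (\<ge>) A)"
        by (intro partial_order_on_relation_ofI) auto
      fix C assume "C \<in> Chains (relation_of (\<ge>) A)"
      then have C: "C \<subseteq> A" "\<And>p p'. p \<in> C \<Longrightarrow> p' \<in> C \<Longrightarrow> p \<le> p' \<or> p' \<le> p"
        by (auto simp: Chains_def relation_of_def)
      show "\<exists>u\<in>A. \<forall>p\<in>C. p \<ge> u"
      proof (cases "C = {}")
        case True
        then show ?thesis using q' by (auto simp: A_def)
      next
        case False
        define m where "m = (\<lambda>x. INF p\<in>C. p x)"
        have sub: "sublinear p" and bound: "p x \<le> q' x" if "p \<in> C" for p x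
          using C that by (auto simp: A_def le_fun_def)
        have "sublinear m" and le: "\<And>p x. p \<in> C \<Longrightarrow> m x \<le> p x"
          using sublinear_INF_chain[of C q'] False sub bound C(2) unfolding m_def by blast+
        moreover have "m \<le> q'"
          using False le bound order_trans unfolding le_fun_def by blast
        ultimately show ?thesis by (auto simp: A_def le_fun_def)
      qed
    qed
    then show ?thesis by auto
  qed
  then obtain m where m: "sublinear m" "m \<le> q'"
    and min: "\<And>p. sublinear p \<Longrightarrow> p \<le> m \<Longrightarrow> p = m"
    unfolding A_def by (blast intro: order_trans)
  have lin: "linear m"
    using minimal_sublinear_linear[OF m(1)] min by (simp add: le_fun_def)
  have le: "m x \<le> q x" for x
    using m(2) q'(2) by (meson le_funD order_trans)
  have "m (- z) \<le> - q z"
    using m(2) q'(3) by (meson le_funD order_trans)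
  then have "m z = q z"
    using le[of z] linear_neg[OF lin, of z] by simp
  with lin le show ?thesis by (rule that)
qed

section \<open>Norming and separating functionals, Alaoglu's theorem\<close>

lemma blinfun_of_dominated_linear:
  fixes f :: "'a::real_normed_vector \<Rightarrow> real"
  assumes "linear f" "\<And>x. f x \<le> norm x"
  obtains g :: "'a \<Rightarrow>\<^sub>L real" where "\<And>x. blinfun_apply g x = f x" "norm g \<le> 1"
proof -
  have bd: "\<bar>f x\<bar> \<le> norm x" for x
    using assms(2)[of x] assms(2)[of "- x"] linear_neg[OF assms(1), of x] by simp
  have "bounded_linear f"
    by (rule bounded_linear_intro[where K = 1])
      (use assms(1) bd in \<open>auto simp: linear_add linear_scale\<close>)
  then have "blinfun_apply (Blinfun f) x = f x" for x by (simp add: bounded_linear_Blinfun_apply)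
  with bd show ?thesis by (intro that[of "Blinfun f"] norm_blinfun_bound) auto
qed

lemma norming_functional:
  fixes x :: "'a::real_normed_vector"
  obtains f :: "'a \<Rightarrow>\<^sub>L real" where "norm f \<le> 1" "blinfun_apply f x = norm x"
proof -
  have "sublinear (norm :: 'a \<Rightarrow> real)"
    by (simp add: sublinear_def norm_triangle_ineq)
  then obtain f where "linear f" "\<And>y. f y \<le> norm y" "f x = norm x"
    using Hahn_Banach_sublinear[of norm x] by blast
  then show ?thesis using that by (metis blinfun_of_dominated_linear)
qed

lemma functionals_separate_points:
  fixes x y :: "'a::real_normed_vector"
  assumes "\<And>f :: 'a \<Rightarrow>\<^sub>L real. blinfun_apply f x = blinfun_apply f y"
  shows "x = y"
proof -
  obtain f :: "'a \<Rightarrow>\<^sub>L real" where "blinfun_apply f (x - y) = norm (x - y)"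
    using norming_functional[of "x - y"] by blast
  then show ?thesis using assms[of f] by (simp add: blinfun.diff_right)
qed

lemma infdist_ge:
  assumes "A \<noteq> {}" "\<And>a. a \<in> A \<Longrightarrow> b \<le> dist x a"
  shows "b \<le> infdist x A"
  using assms by (auto simp: infdist_notempty intro: cINF_greatest)

lemma sublinear_infdist:
  assumes Y: "subspace (Y :: 'a::real_normed_vector set)"
  shows "sublinear (\<lambda>x. infdist x Y)"
proof -
  have ne: "Y \<noteq> {}" using subspace_0[OF Y] by blast
  have add: "infdist (x + y) Y \<le> infdist x Y + infdist y Y" for x y
  proof -
    have "infdist (x + y) Y \<le> dist x a + dist y b" if "a \<in> Y" "b \<in> Y" for a b
      using infdist_le[OF subspace_add[OF Y that], of "x + y"] norm_triangle_ineq[of "x - a" "y - b"]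
      by (simp add: dist_norm algebra_simps)
    then have "infdist (x + y) Y - dist x a \<le> infdist y Y" if "a \<in> Y" for a
      using that ne by (intro infdist_ge) (auto simp: diff_le_eq add.commute[of _ "dist x a"])
    then have "infdist (x + y) Y - infdist y Y \<le> infdist x Y"
      using ne by (intro infdist_ge) (auto simp: algebra_simps)
    then show ?thesis by simp
  qed
  have "infdist (c *\<^sub>R x) Y \<le> c * infdist x Y" if "c > 0" for c x
  proof -
    have "infdist (c *\<^sub>R x) Y / c \<le> dist x a" if "a \<in> Y" for a
    proof -
      have "infdist (c *\<^sub>R x) Y \<le> norm (c *\<^sub>R (x - a))"
        using infdist_le[OF subspace_scale[OF Y that], of "c *\<^sub>R x" c]
        by (simp add: dist_norm scaleR_diff_right)
      then have "infdist (c *\<^sub>R x) Y \<le> c * dist x a"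
        using \<open>c > 0\<close> by (simp add: dist_norm del: scaleR_diff_right)
      then show ?thesis using \<open>c > 0\<close> by (simp add: field_simps)
    qed
    then have "infdist (c *\<^sub>R x) Y / c \<le> infdist x Y" using ne by (intro infdist_ge)
    then show ?thesis using that by (simp add: field_simps)
  qed
  with add show ?thesis by (simp add: sublinear_def)
qed

text \<open>A linear functional dominated by the distance to \<open>Y\<close> vanishes on
  \<open>Y\<close>, because \<open>y\<close> and \<open>- y\<close> both have distance 0. At
  \<open>z\<close> it is made equal to the distance, which is nonzero as \<open>Y\<close> is
  closed.\<close>

lemma functional_separating_subspace:
  fixes Y :: "'a::real_normed_vector set"
  assumes Y: "subspace Y" "closed Y" and z: "z \<notin> Y"
  obtains f :: "'a \<Rightarrow>\<^sub>L real" where "\<And>y. y \<in> Y \<Longrightarrow> blinfun_apply f y = 0" "blinfun_apply f z \<noteq> 0"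
proof -
  obtain f where f: "linear f" "\<And>x. f x \<le> infdist x Y" "f z = infdist z Y"
    using Hahn_Banach_sublinear[OF sublinear_infdist[OF Y(1)]] by blast
  have "infdist x Y \<le> norm x" for x
    using infdist_le[OF subspace_0[OF Y(1)], of x] by simp
  then have "f x \<le> norm x" for x using f(2) order_trans by blast
  then obtain g :: "'a \<Rightarrow>\<^sub>L real" where g: "\<And>x. blinfun_apply g x = f x"
    using blinfun_of_dominated_linear[OF f(1)] by metis
  have "f y = 0" if "y \<in> Y" for y
  proof -
    have "f y \<le> 0" "f (- y) \<le> 0"
      using f(2)[of y] f(2)[of "- y"] that subspace_neg[OF Y(1) that] by auto
    then show ?thesis using linear_neg[OF f(1), of y] by simp
  qed
  moreover have "infdist z Y \<noteq> 0"
    using Y z subspace_0[OF Y(1)] in_closed_iff_infdist_zero[of Y z] by blast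
  ultimately show ?thesis using that[of g] g f(3) by simp
qed

lemma blinfun_almost_norming:
  fixes T :: "'a::real_normed_vector \<Rightarrow>\<^sub>L 'b::real_normed_vector"
  obtains x where "norm x \<le> 1" "norm T \<le> 2 * norm (blinfun_apply T x)"
proof (rule ccontr)
  assume "\<not> thesis"
  with that have *: "\<And>x. norm x \<le> 1 \<Longrightarrow> 2 * norm (blinfun_apply T x) < norm T"
    by (meson not_le)
  have "norm (blinfun_apply T x) \<le> norm T / 2 * norm x" for x
    using *[of "x /\<^sub>R norm x"] by (cases "x = 0") (auto simp: blinfun.scaleR_right field_simps)
  then have "norm T \<le> norm T / 2" by (intro norm_blinfun_bound) auto
  then show False using *[of 0] by simp
qed

text \<open>Tychonoff's theorem for the intervals from \<open>- norm x\<close> to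
  \<open>norm x\<close> yields a cluster point. The filter of indices is refined, rather than one of
  functionals, so that limits carry over to sequences built from the \<open>f i\<close>.\<close>

lemma Alaoglu_filter_cluster:
  fixes f :: "'i \<Rightarrow> 'a::real_normed_vector \<Rightarrow>\<^sub>L real"
  assumes f: "\<And>i. norm (f i) \<le> 1" and "H \<noteq> bot"
  obtains G \<phi> where "G \<le> H" "G \<noteq> bot" "norm \<phi> \<le> 1"
    "\<And>x. ((\<lambda>i. blinfun_apply (f i) x) \<longlongrightarrow> blinfun_apply \<phi> x) G"
proof -
  define K where "K = PiE UNIV (\<lambda>x::'a. {- norm x .. norm x})"
  have "compactin (product_topology (\<lambda>_. euclidean) UNIV) K"
    unfolding K_def by (subst compactin_PiE) auto
  then have "compact K" by (simp add: euclidean_product_topology)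
  have bd: "\<bar>blinfun_apply (f i) x\<bar> \<le> norm x" for i x
    using norm_blinfun[of "f i" x] mult_right_mono[OF f[of i], of "norm x"] by simp
  define F where "F = filtermap (\<lambda>i. blinfun_apply (f i)) H"
  have "F \<noteq> bot" using \<open>H \<noteq> bot\<close> by (simp add: F_def filtermap_bot_iff)
  have "blinfun_apply (f i) \<in> K" for i
    using bd[of i] by (auto simp: K_def abs_le_iff minus_le_iff)
  then have "eventually (\<lambda>g. g \<in> K) F" by (simp add: F_def eventually_filtermap)
  with \<open>compact K\<close> \<open>F \<noteq> bot\<close> obtain g where g: "g \<in> K" "inf (nhds g) F \<noteq> bot"
    unfolding compact_filter by blast
  \<comment> \<open>\<open>H\<close> is refined by the preimages of neighbourhoods of
    \<open>g\<close>; the refinement is proper because \<open>g\<close> is a cluster point of the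
    image filter.\<close>
  define G where "G = inf H (filtercomap (\<lambda>i. blinfun_apply (f i)) (nhds g))"
  have "G \<noteq> bot"
  proof
    assume "G = bot"
    then have "eventually (\<lambda>_. False) G" by simp
    then obtain P Q where P: "eventually P H" and
      Q: "eventually Q (filtercomap (\<lambda>i. blinfun_apply (f i)) (nhds g))" and
      PQ: "\<And>i. P i \<Longrightarrow> Q i \<Longrightarrow> False"
      unfolding G_def eventually_inf by blast
    obtain R where R: "eventually R (nhds g)" "\<And>i. R (blinfun_apply (f i)) \<Longrightarrow> Q i"
      using Q unfolding eventually_filtercomap by blast
    have "eventually (\<lambda>h. \<not> R h) F"
      unfolding F_def eventually_filtermap by (rule eventually_mono[OF P]) (use PQ R(2) in blast)
    then have "eventually (\<lambda>_. False) (inf (nhds g) F)"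
      using R(1) unfolding eventually_inf by blast
    then show False using g(2) by (simp add: trivial_limit_def)
  qed
  have "filterlim (\<lambda>i. blinfun_apply (f i)) (nhds g) G"
    unfolding G_def filterlim_iff_le_filtercomap by simp
  then have lim: "((\<lambda>i. blinfun_apply (f i) x) \<longlongrightarrow> g x) G" for x
    by (rule continuous_on_tendsto_compose[OF continuous_on_product_coordinates[of x]]) auto
  have "linear g"
  proof (rule linearI)
    fix x y c
    show "g (x + y) = g x + g y"
      by (rule tendsto_unique[OF \<open>G \<noteq> bot\<close> lim])
        (use tendsto_add[OF lim[of x] lim[of y]] in \<open>simp add: blinfun.add_right\<close>)
    show "g (c *\<^sub>R x) = c *\<^sub>R g x"
      by (rule tendsto_unique[OF \<open>G \<noteq> bot\<close> lim])
        (use tendsto_mult_left[OF lim[of x], of c] in \<open>simp add: blinfun.scaleR_right\<close>)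
  qed
  moreover have "g x \<le> norm x" for x using g(1) by (auto simp: K_def)
  ultimately obtain \<phi> :: "'a \<Rightarrow>\<^sub>L real" where "\<And>x. blinfun_apply \<phi> x = g x" "norm \<phi> \<le> 1"
    using blinfun_of_dominated_linear by metis
  with that[of G \<phi>] \<open>G \<noteq> bot\<close> lim show ?thesis by (simp add: G_def)
qed

section \<open>Weak compactness in spaces with the Schur property\<close>

text \<open>A countable product of intervals is sequentially compact as well as compact; this takes
  the place of a diagonal argument.\<close>

lemma pointwise_convergent_subsequence:
  fixes F :: "nat \<Rightarrow> nat \<Rightarrow> real"
  assumes "\<And>n k. \<bar>F n k\<bar> \<le> B k"
  obtains r where "strict_mono r" "\<And>k. convergent (\<lambda>n. F (r n) k)"
proof -
  define K where "K = PiE UNIV (\<lambda>k. {- B k .. B k})"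
  have "compactin (product_topology (\<lambda>_. euclidean) UNIV) K"
    unfolding K_def by (subst compactin_PiE) auto
  then have "compact K" by (simp add: euclidean_product_topology)
  moreover have "F n \<in> K" for n
    using assms[of n] by (auto simp: K_def abs_le_iff minus_le_iff)
  ultimately obtain l r where r: "strict_mono r" "(F \<circ> r) \<longlonglongrightarrow> l"
    using seq_compactE[OF compact_imp_seq_compact[of K], of F] by blast
  have "(\<lambda>n. F (r n) k) \<longlonglongrightarrow> l k" for k
    using continuous_on_tendsto_compose[OF continuous_on_product_coordinates[of k] r(2)]
    by (simp add: o_def)
  with r(1) that show ?thesis unfolding convergent_def by blast
qed

lemma countable_dense_in_subspace:
  fixes z :: "nat \<Rightarrow> 'a::real_normed_vector"
  obtains D where "countable D" "range z \<subseteq> D" "subspace (closure D)"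
proof -
  \<comment> \<open>Lists of pairs encode rational combinations: concatenation is addition, and
    countability of \<open>D\<close> comes from that of the list type.\<close>
  define s where "s l = (\<Sum>(q, i)\<leftarrow>l. of_rat q *\<^sub>R z i)" for l :: "(rat \<times> nat) list"
  define D where "D = range s"
  have zD: "z n \<in> D" for n
    unfolding D_def by (rule range_eqI[of _ _ "[(1, n)]"]) (simp add: s_def)
  have D0: "0 \<in> D" unfolding D_def by (rule range_eqI[of _ _ "[]"]) (simp add: s_def)
  have add: "x + y \<in> D" if "x \<in> D" "y \<in> D" for x y
  proof -
    have "s l + s l' = s (l @ l')" for l l' by (simp add: s_def)
    then show ?thesis using that by (auto simp: D_def)
  qed
  have scale: "of_rat q *\<^sub>R x \<in> D" if "x \<in> D" for q x
  proof -
    have "of_rat q *\<^sub>R s l = s (map (\<lambda>(q', i). (q * q', i)) l)" for l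
      by (induction l) (auto simp: s_def scaleR_add_right of_rat_mult)
    then show ?thesis using that by (auto simp: D_def)
  qed
  have "subspace (closure D)"
  proof (rule subspaceI)
    show "0 \<in> closure D" using D0 closure_subset by blast
  next
    fix x y assume "x \<in> closure D" "y \<in> closure D"
    then obtain a b where "\<And>n. a n \<in> D" "a \<longlonglongrightarrow> x" "\<And>n. b n \<in> D" "b \<longlonglongrightarrow> y"
      unfolding closure_sequential by blast
    then show "x + y \<in> closure D"
      unfolding closure_sequential
      by (intro exI[of _ "\<lambda>n. a n + b n"]) (auto intro: add tendsto_add)
  next
    fix c :: real and x assume "x \<in> closure D"
    then obtain a where a: "\<And>n. a n \<in> D" "a \<longlonglongrightarrow> x"
      unfolding closure_sequential by blast
    have "c \<in> closure \<rat>" using Rats_closure_real by blast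
    then obtain q where q: "\<And>n. q n \<in> \<rat>" "q \<longlonglongrightarrow> c"
      unfolding closure_sequential by blast
    have "q n *\<^sub>R a n \<in> D" for n
    proof -
      obtain t where "q n = of_rat t" using q(1)[of n] by (rule Rats_cases)
      then show ?thesis using scale[OF a(1)] by simp
    qed
    moreover have "(\<lambda>n. q n *\<^sub>R a n) \<longlonglongrightarrow> c *\<^sub>R x" using q(2) a(2) by (rule tendsto_scaleR)
    ultimately show "c *\<^sub>R x \<in> closure D"
      unfolding closure_sequential by (intro exI[of _ "\<lambda>n. q n *\<^sub>R a n"]) simp
  qed
  moreover have "countable D" by (simp add: D_def)
  ultimately show ?thesis using that zD by blast
qed

text \<open>
  An operator \<open>S\<close> whose adjoint takes values in the predual maps the dual unit ball to a
  relatively weakly compact set. As in the Eberlein-Smulian theorem, a subsequence along which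
  countably many functionals norming a dense subset of the closed span converge has only one
  weak cluster point.
\<close>

lemma weakly_convergent_subsequence:
  fixes S :: "('b::real_normed_vector \<Rightarrow>\<^sub>L real) \<Rightarrow> 'a::real_normed_vector"
    and f :: "nat \<Rightarrow> 'b \<Rightarrow>\<^sub>L real"
  assumes adj: "\<And>g :: 'a \<Rightarrow>\<^sub>L real. \<exists>y. \<forall>\<phi>. blinfun_apply g (S \<phi>) = blinfun_apply \<phi> y"
    and f: "\<And>n. norm (f n) \<le> 1"
  obtains r l where "strict_mono r" "limitin weak_topology (\<lambda>n. S (f (r n))) l sequentially"
proof -
  define z where "z n = S (f n)" for n
  obtain D where D: "countable D" "range z \<subseteq> D" "subspace (closure D)"
    by (rule countable_dense_in_subspace[of z])
  then have "D \<noteq> {}" by blast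
  define d where "d = from_nat_into D"
  have D_eq: "D = range d" using D(1) \<open>D \<noteq> {}\<close> by (simp add: d_def)
  have "\<exists>g :: 'a \<Rightarrow>\<^sub>L real. norm g \<le> 1 \<and> blinfun_apply g (d k) = norm (d k)" for k
    using norming_functional by blast
  then obtain g :: "nat \<Rightarrow> 'a \<Rightarrow>\<^sub>L real"
    where g: "\<And>k. norm (g k) \<le> 1" "\<And>k. blinfun_apply (g k) (d k) = norm (d k)"
    by metis
  \<comment> \<open>By \<open>adj\<close>, \<open>g k\<close> at \<open>z n\<close> equals
    \<open>f n\<close> at a point \<open>y\<close> independent of \<open>n\<close>.\<close>
  have "\<exists>B. \<forall>n. \<bar>blinfun_apply (g k) (z n)\<bar> \<le> B" for k
  proof -
    obtain y where y: "\<And>\<phi>. blinfun_apply (g k) (S \<phi>) = blinfun_apply \<phi> y"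
      using adj by blast
    have "\<bar>blinfun_apply (f n) y\<bar> \<le> norm y" for n
      using norm_blinfun[of "f n" y] mult_right_mono[OF f[of n], of "norm y"] by simp
    then show ?thesis by (intro exI[of _ "norm y"]) (simp add: z_def y)
  qed
  then obtain B where "\<And>k n. \<bar>blinfun_apply (g k) (z n)\<bar> \<le> B k" by metis
  then obtain r where r: "strict_mono r" "\<And>k. convergent (\<lambda>n. blinfun_apply (g k) (z (r n)))"
    using pointwise_convergent_subsequence[of "\<lambda>n k. blinfun_apply (g k) (z n)" B] by blast
  then obtain L where L: "\<And>k. (\<lambda>n. blinfun_apply (g k) (z (r n))) \<longlonglongrightarrow> L k"
    unfolding convergent_def by metis
  \<comment> \<open>Any proper filter finer than \<open>sequentially\<close> has a weak cluster
    point \<open>S \<phi>\<close>. The values of the \<open>g k\<close> there are already determined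
    by the choice of \<open>r\<close>.\<close>
  have cluster: "\<exists>l G. G \<le> H \<and> G \<noteq> bot \<and> l \<in> closure D \<and> (\<forall>k. blinfun_apply (g k) l = L k) \<and>
      (\<forall>h :: 'a \<Rightarrow>\<^sub>L real. ((\<lambda>n. blinfun_apply h (z (r n))) \<longlongrightarrow> blinfun_apply h l) G)"
    if H: "H \<noteq> bot" "H \<le> sequentially" for H
  proof -
    obtain G \<phi> where G: "G \<le> H" "G \<noteq> bot"
      and \<phi>: "\<And>x. ((\<lambda>n. blinfun_apply (f (r n)) x) \<longlongrightarrow> blinfun_apply \<phi> x) G"
      using Alaoglu_filter_cluster[of "\<lambda>n. f (r n)", OF f H(1)] by blast
    have lim: "((\<lambda>n. blinfun_apply h (z (r n))) \<longlongrightarrow> blinfun_apply h (S \<phi>)) G" for h :: "'a \<Rightarrow>\<^sub>L real"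
      using adj[of h] \<phi> by (auto simp: z_def)
    \<comment> \<open>A closed subspace is weakly closed: functionals vanishing on it also vanish at
      weak limits.\<close>
    have "S \<phi> \<in> closure D"
    proof (rule ccontr)
      assume "S \<phi> \<notin> closure D"
      then obtain h :: "'a \<Rightarrow>\<^sub>L real" where h: "\<And>x. x \<in> closure D \<Longrightarrow> blinfun_apply h x = 0"
        "blinfun_apply h (S \<phi>) \<noteq> 0"
        using functional_separating_subspace[OF D(3) closed_closure] by blast
      have "z (r n) \<in> closure D" for n
        using D(2) closure_subset[of D] rangeI[of z "r n"] by (meson subsetD)
      then have "blinfun_apply h (z (r n)) = 0" for n by (rule h(1))
      then have "blinfun_apply h (S \<phi>) = 0"
        using tendsto_unique[OF G(2) lim[of h], of 0] by simp
      with h(2) show False by simp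
    qed
    moreover have "blinfun_apply (g k) (S \<phi>) = L k" for k
      using tendsto_unique[OF G(2) lim tendsto_mono[OF order_trans[OF G(1) H(2)] L]] .
    ultimately show ?thesis using G lim by blast
  qed
  \<comment> \<open>Let \<open>d k\<close> be within \<open>e\<close> of \<open>l - l'\<close>.
    Since \<open>g k\<close> annihilates \<open>l - l'\<close> and norms \<open>d k\<close>,
    \<open>norm (d k) < e\<close>, so \<open>l - l'\<close> has norm at most
    \<open>2 * e\<close>.\<close>
  have uniq: "l = l'" if "l \<in> closure D" "l' \<in> closure D"
    "\<And>k. blinfun_apply (g k) l = blinfun_apply (g k) l'" for l l'
  proof -
    have in_D: "l - l' \<in> closure D" by (rule subspace_diff[OF D(3) that(1,2)])
    have "norm (l - l') \<le> 2 * e" if "e > 0" for e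
    proof -
      obtain k where k: "dist (d k) (l - l') < e"
        using in_D \<open>e > 0\<close> unfolding closure_approachable D_eq by blast
      have "blinfun_apply (g k) (d k) = blinfun_apply (g k) (d k - (l - l'))"
        using \<open>\<And>k. blinfun_apply (g k) l = blinfun_apply (g k) l'\<close>
        by (simp add: blinfun.diff_right)
      also have "\<dots> \<le> norm (g k) * norm (d k - (l - l'))"
        using norm_blinfun[of "g k" "d k - (l - l')"] by simp
      also have "\<dots> \<le> norm (d k - (l - l'))"
        using mult_right_mono[OF g(1)[of k], of "norm (d k - (l - l'))"] by simp
      finally have "norm (d k) < e" using k by (simp add: g(2) dist_norm)
      then show ?thesis
        using norm_triangle_sub[of "l - l'" "d k"] k by (simp add: dist_norm norm_minus_commute)
    qed
    from this[of "norm (l - l') / 4"] show ?thesis by (cases "l = l'") auto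
  qed
  obtain l where l: "l \<in> closure D" "\<And>k. blinfun_apply (g k) l = L k"
    using cluster[of sequentially] by auto
  have "(\<lambda>n. blinfun_apply h (z (r n))) \<longlonglongrightarrow> blinfun_apply h l" for h :: "'a \<Rightarrow>\<^sub>L real"
  proof (rule ccontr)
    assume "\<not> ?thesis"
    then obtain e where e: "e > 0"
      "\<not> eventually (\<lambda>n. dist (blinfun_apply h (z (r n))) (blinfun_apply h l) < e) sequentially"
      unfolding tendsto_iff by blast
    \<comment> \<open>\<open>H\<close> lives on the indices where \<open>h\<close> stays
      \<open>e\<close> away from its value at \<open>l\<close>. It is proper because convergence
      fails, yet by \<open>uniq\<close> its cluster point is \<open>l\<close>.\<close>
    define H where
      "H = inf sequentially (principal {n. \<not> dist (blinfun_apply h (z (r n))) (blinfun_apply h l) < e})"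
    have "H \<noteq> bot"
      using e(2) unfolding H_def trivial_limit_def eventually_inf_principal by simp
    moreover have "H \<le> sequentially" by (simp add: H_def)
    ultimately obtain l' G where G: "G \<le> H" "G \<noteq> bot" and l': "l' \<in> closure D"
      "\<And>k. blinfun_apply (g k) l' = L k"
      and lim: "((\<lambda>n. blinfun_apply h (z (r n))) \<longlongrightarrow> blinfun_apply h l') G"
      using cluster by blast
    have "l' = l" using uniq[OF l'(1) l(1)] l'(2) l(2) by simp
    then have "eventually (\<lambda>n. dist (blinfun_apply h (z (r n))) (blinfun_apply h l) < e) G"
      using lim e(1) unfolding tendsto_iff by blast
    moreover have "eventually (\<lambda>n. \<not> dist (blinfun_apply h (z (r n))) (blinfun_apply h l) < e) H"
      unfolding H_def eventually_inf_principal by simp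
    then have "eventually (\<lambda>n. \<not> dist (blinfun_apply h (z (r n))) (blinfun_apply h l) < e) G"
      using G(1) by (rule filter_leD[rotated])
    ultimately have "eventually (\<lambda>_. False) G" by eventually_elim blast
    then show False using G(2) by (simp add: trivial_limit_def)
  qed
  then have "limitin weak_topology (\<lambda>n. S (f (r n))) l sequentially"
    by (simp add: limitin_weak_topology z_def)
  with r(1) show ?thesis by (rule that)
qed

text \<open>\<open>Schur_property\<close> yields only some norm limit; the functionals identify it
  as 0.\<close>

lemma Schur_weakly_null_imp_null:
  fixes x :: "nat \<Rightarrow> 'a::real_normed_vector"
  assumes "Schur_property TYPE('a)"
    and null: "\<And>f :: 'a \<Rightarrow>\<^sub>L real. (\<lambda>n. blinfun_apply f (x n)) \<longlonglongrightarrow> 0"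
  shows "x \<longlonglongrightarrow> 0"
proof -
  have "limitin weak_topology x 0 sequentially" by (simp add: limitin_weak_topology null)
  then obtain l where l: "x \<longlonglongrightarrow> l"
    using assms(1) unfolding Schur_property_def convergent_def by blast
  have "l = 0"
  proof (rule functionals_separate_points)
    fix f :: "'a \<Rightarrow>\<^sub>L real"
    show "blinfun_apply f l = blinfun_apply f 0"
      using LIMSEQ_unique[OF blinfun.tendsto[OF tendsto_const l] null[of f]] by simp
  qed
  with l show ?thesis by simp
qed

section \<open>Total boundedness and Schauder's theorem\<close>

lemma totally_bounded_iff_Cauchy_subsequence:
  fixes A :: "'a::metric_space set"
  shows "Met_TC.mtotally_bounded A \<longleftrightarrow>
    (\<forall>\<sigma>::nat \<Rightarrow> 'a. range \<sigma> \<subseteq> A \<longrightarrow> (\<exists>r. strict_mono r \<and> Cauchy (\<sigma> \<circ> r)))"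
  by (simp add: Met_TC.mtotally_bounded_sequentially)

lemma compact_closure_if_totally_bounded:
  fixes A :: "'a::complete_space set"
  assumes "Met_TC.mtotally_bounded A"
  shows "compact (closure A)"
  using assms Met_TC.mtotally_bounded_eq_compact_closure_of[of A]
  by (simp add: complete_UNIV)

lemma Schur_totally_bounded_image:
  fixes S :: "('b::real_normed_vector \<Rightarrow>\<^sub>L real) \<Rightarrow> 'a::real_normed_vector"
  assumes Schur: "Schur_property TYPE('a)"
    and adj: "\<And>g :: 'a \<Rightarrow>\<^sub>L real. \<exists>y. \<forall>\<phi>. blinfun_apply g (S \<phi>) = blinfun_apply \<phi> y"
  shows "Met_TC.mtotally_bounded (S ` cball 0 1)"
  unfolding totally_bounded_iff_Cauchy_subsequence
proof (intro allI impI)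
  fix \<sigma> :: "nat \<Rightarrow> 'a" assume "range \<sigma> \<subseteq> S ` cball 0 1"
  then have "\<sigma> n \<in> S ` cball 0 1" for n by (rule subsetD) (rule rangeI)
  then have "\<exists>\<phi>. norm \<phi> \<le> 1 \<and> \<sigma> n = S \<phi>" for n by (rule imageE) auto
  then obtain f where f: "\<And>n. norm (f n) \<le> 1" "\<And>n. \<sigma> n = S (f n)" by metis
  obtain r l where r: "strict_mono r" "limitin weak_topology (\<lambda>n. S (f (r n))) l sequentially"
    by (rule weakly_convergent_subsequence[OF adj f(1)])
  show "\<exists>r. strict_mono r \<and> Cauchy (\<sigma> \<circ> r)"
  proof (intro exI conjI)
    have "convergent (\<lambda>n. S (f (r n)))"
      using Schur r(2) unfolding Schur_property_def by metis
    then show "Cauchy (\<sigma> \<circ> r)" unfolding o_def f(2) by (rule convergent_Cauchy)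
    show "strict_mono r" by (rule r(1))
  qed
qed

text \<open>For a difference \<open>h\<close> of two functionals, the norm of \<open>T h\<close> is
  \<open>h (S g)\<close> with \<open>g\<close> norming in the dual ball. Finite nets of the image of
  \<open>S\<close> thus reduce the Cauchy property to pointwise convergence at countably many net
  points.\<close>

lemma Schauder_totally_bounded:
  fixes T :: "('a::real_normed_vector \<Rightarrow>\<^sub>L real) \<Rightarrow>\<^sub>L 'b::real_normed_vector"
    and S :: "('b \<Rightarrow>\<^sub>L real) \<Rightarrow> 'a"
  assumes adj: "\<And>f g. blinfun_apply f (S g) = blinfun_apply g (blinfun_apply T f)"
    and S: "Met_TC.mtotally_bounded (S ` cball 0 1)"
  shows "Met_TC.mtotally_bounded (blinfun_apply T ` cball 0 1)"
  unfolding Met_TC.mtotally_bounded_sequentially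
proof (intro conjI allI impI)
  fix \<sigma> :: "nat \<Rightarrow> 'b" assume "range \<sigma> \<subseteq> blinfun_apply T ` cball 0 1"
  then have "\<sigma> n \<in> blinfun_apply T ` cball 0 1" for n by (rule subsetD) (rule rangeI)
  then have "\<exists>f. norm f \<le> 1 \<and> \<sigma> n = blinfun_apply T f" for n by (rule imageE) auto
  then obtain f where f: "\<And>n. norm (f n) \<le> 1" "\<And>n. \<sigma> n = blinfun_apply T (f n)" by metis
  have "\<exists>D. finite D \<and> S ` cball 0 1 \<subseteq> (\<Union>d\<in>D. ball d (inverse (real (Suc m))))" for m
  proof -
    have "inverse (real (Suc m)) > 0" by simp
    with S show ?thesis unfolding Met_TC.mtotally_bounded_def mball_eq_ball by blast
  qed
  then obtain D where D: "\<And>m. finite (D m)"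
    "\<And>m. S ` cball 0 1 \<subseteq> (\<Union>d\<in>D m. ball d (inverse (real (Suc m))))" by metis
  \<comment> \<open>Inserting 0 guarantees a nonempty set, so that \<open>from_nat_into\<close>
    enumerates exactly this set.\<close>
  define d where "d = from_nat_into (insert 0 (\<Union>m. D m))"
  have "countable (insert 0 (\<Union>m. D m))"
    using D(1) by (auto intro: countable_finite)
  then have range_d: "range d = insert 0 (\<Union>m. D m)" by (simp add: d_def)
  have "\<bar>blinfun_apply (f n) (d k)\<bar> \<le> norm (d k)" for n k
    using norm_blinfun[of "f n" "d k"] mult_right_mono[OF f(1)[of n], of "norm (d k)"] by simp
  then obtain r where r: "strict_mono r" "\<And>k. convergent (\<lambda>n. blinfun_apply (f (r n)) (d k))"
    using pointwise_convergent_subsequence[of "\<lambda>n k. blinfun_apply (f n) (d k)" "\<lambda>k. norm (d k)"]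
    by blast
  have conv: "Cauchy (\<lambda>n. blinfun_apply (f (r n)) x)" if "x \<in> D m" for x m
  proof -
    have "x \<in> range d" using that range_d by blast
    then show ?thesis using r(2) convergent_Cauchy by blast
  qed
  have "Cauchy (\<lambda>n. \<sigma> (r n))"
  proof (rule metric_CauchyI)
    fix e :: real assume "e > 0"
    \<comment> \<open>One quarter of \<open>e\<close> is spent at the net point and two on the
      distance to it, since a difference of two functionals from the ball has norm at most
      2.\<close>
    then obtain m where m: "inverse (real (Suc m)) < e / 4"
      using reals_Archimedean[of "e / 4"] by auto
    have "\<exists>N. \<forall>i\<ge>N. \<forall>j\<ge>N. dist (blinfun_apply (f (r i)) x) (blinfun_apply (f (r j)) x) < e / 4"
      if "x \<in> D m" for x
      using metric_CauchyD[OF conv[OF that], of "e / 4"] \<open>e > 0\<close> by simp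
    then obtain N where N: "\<And>x i j. x \<in> D m \<Longrightarrow> i \<ge> N x \<Longrightarrow> j \<ge> N x \<Longrightarrow>
        dist (blinfun_apply (f (r i)) x) (blinfun_apply (f (r j)) x) < e / 4"
      by metis
    define N0 where "N0 = Max (insert 0 (N ` D m))"
    have "N x \<le> N0" if "x \<in> D m" for x
      using that D(1)[of m] by (simp add: N0_def)
    have "dist (\<sigma> (r i)) (\<sigma> (r j)) < e" if "i \<ge> N0" "j \<ge> N0" for i j
    proof -
      let ?h = "f (r i) - f (r j)"
      obtain g :: "'b \<Rightarrow>\<^sub>L real" where g: "norm g \<le> 1"
        "blinfun_apply g (blinfun_apply T ?h) = norm (blinfun_apply T ?h)"
        using norming_functional by blast
      then have "S g \<in> (\<Union>d\<in>D m. ball d (inverse (real (Suc m))))"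
        by (intro subsetD[OF D(2)] imageI) simp
      then obtain x where x: "x \<in> D m" "dist x (S g) < inverse (real (Suc m))"
        unfolding UN_iff mem_ball by blast
      have "norm ?h \<le> 2" using norm_triangle_ineq4[of "f (r i)" "f (r j)"] f(1)[of "r i"] f(1)[of "r j"]
        by linarith
      have "dist (\<sigma> (r i)) (\<sigma> (r j)) = blinfun_apply ?h (S g)"
        by (simp add: f(2) adj g(2) dist_norm flip: blinfun.diff_right)
      also have "\<dots> = blinfun_apply ?h x + blinfun_apply ?h (S g - x)"
        by (simp add: blinfun.diff_right)
      also have "blinfun_apply ?h x < e / 4"
        using N[OF x(1), of i j] \<open>\<And>x. x \<in> D m \<Longrightarrow> N x \<le> N0\<close>[OF x(1)] that
        unfolding dist_real_def blinfun.diff_left by linarith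
      also have "blinfun_apply ?h (S g - x) \<le> norm ?h * norm (S g - x)"
        using norm_blinfun[of ?h "S g - x"] by simp
      also have "\<dots> \<le> 2 * (e / 4)"
        using \<open>norm ?h \<le> 2\<close> x(2) m by (intro mult_mono) (auto simp: dist_norm norm_minus_commute)
      finally show ?thesis using \<open>e > 0\<close> by simp
    qed
    then show "\<exists>M. \<forall>i\<ge>M. \<forall>j\<ge>M. dist (\<sigma> (r i)) (\<sigma> (r j)) < e" by blast
  qed
  with r(1) show "\<exists>r. strict_mono r \<and> Met_TC.MCauchy (\<sigma> \<circ> r)" by (auto simp: o_def)
qed auto

section \<open>Weak-star to weak continuous operators\<close>

text \<open>Induction on the points. If some \<open>h\<close> vanishes on \<open>I\<close> but not
  at \<open>a\<close>, subtracting the multiple of evaluation at \<open>a\<close> that matches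
  \<open>u\<close> at \<open>h\<close> leaves a functional handled by \<open>I\<close>. Otherwise
  vanishing on \<open>I\<close> already forces vanishing at \<open>a\<close>.\<close>

lemma evaluation_of_common_kernel:
  fixes u :: "('a::real_normed_vector \<Rightarrow>\<^sub>L real) \<Rightarrow> real"
  assumes "finite I" "linear u"
    and "\<And>f. (\<And>x. x \<in> I \<Longrightarrow> blinfun_apply f x = 0) \<Longrightarrow> u f = 0"
  shows "\<exists>x. \<forall>f. u f = blinfun_apply f x"
  using assms
proof (induction I arbitrary: u rule: finite_induct)
  case empty
  then show ?case by (intro exI[of _ 0]) simp
next
  case (insert a I)
  show ?case
  proof (cases "\<exists>h :: 'a \<Rightarrow>\<^sub>L real. (\<forall>x\<in>I. blinfun_apply h x = 0) \<and> blinfun_apply h a \<noteq> 0")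
    case True
    then obtain h :: "'a \<Rightarrow>\<^sub>L real"
      where h: "\<And>x. x \<in> I \<Longrightarrow> blinfun_apply h x = 0" "blinfun_apply h a \<noteq> 0"
      by blast
    define v where "v f = u f - (u h / blinfun_apply h a) * blinfun_apply f a" for f
    have "linear v"
      using insert.prems(1) by (auto intro!: linearI simp: v_def linear_add linear_scale
          blinfun.add_left blinfun.scaleR_left algebra_simps)
    moreover have "v f = 0" if f: "\<And>x. x \<in> I \<Longrightarrow> blinfun_apply f x = 0" for f
    proof -
      have "u (f - (blinfun_apply f a / blinfun_apply h a) *\<^sub>R h) = 0"
        using f h by (intro insert.prems(2)) (auto simp: blinfun.diff_left blinfun.scaleR_left)
      then show ?thesis
        using insert.prems(1) by (simp add: v_def linear_diff linear_scale)
    qed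
    ultimately obtain x where x: "\<And>f. v f = blinfun_apply f x" using insert.IH by blast
    have "u f = blinfun_apply f (x + (u h / blinfun_apply h a) *\<^sub>R a)" for f
      using x[of f] by (simp add: v_def blinfun.add_right blinfun.scaleR_right)
    then show ?thesis by blast
  next
    case False
    then show ?thesis using insert by blast
  qed
qed

text \<open>Continuity at 0 bounds \<open>u\<close> by 1 on a neighbourhood that restricts only
  finitely many coordinates. Functionals vanishing at these points remain inside under all scalings,
  so \<open>u\<close> kills them and the kernel lemma applies.\<close>

lemma weakstar_continuous_linear_evaluation:
  fixes u :: "('a::real_normed_vector \<Rightarrow>\<^sub>L real) \<Rightarrow> real"
  assumes u: "linear u" and cont: "continuous_map weakstar_topology euclidean u"
  shows "\<exists>x. \<forall>f. u f = blinfun_apply f x"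
proof -
  have "openin (weakstar_topology :: ('a \<Rightarrow>\<^sub>L real) topology) {f. u f \<in> {-1<..<1}}"
    using openin_continuous_map_preimage[OF cont, of "{-1<..<1}"]
    by (simp add: strong_operator_topology_topspace)
  then obtain V where V: "open V" "{f. u f \<in> {-1<..<1}} = blinfun_apply -` V"
    unfolding strong_operator_topology_def openin_pullback_topology by auto
  have "0 \<in> {f. u f \<in> {-1<..<1}}" using linear_0[OF u] by simp
  then have "blinfun_apply 0 \<in> V" using V(2) by blast
  then obtain X where X: "blinfun_apply 0 \<in> PiE UNIV X"
    "finite {x. X x \<noteq> UNIV}" "PiE UNIV X \<subseteq> V"
    using product_topology_open_contains_basis[of "\<lambda>_. euclidean" UNIV V "blinfun_apply 0"] V(1)
    by (auto simp: euclidean_product_topology)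
  have "u f = 0" if f: "\<And>x. x \<in> {x. X x \<noteq> UNIV} \<Longrightarrow> blinfun_apply f x = 0" for f
  proof (rule ccontr)
    assume "u f \<noteq> 0"
    have "blinfun_apply (inverse (u f) *\<^sub>R f) x \<in> X x" for x
    proof (cases "X x = UNIV")
      case False
      then show ?thesis using f[of x] X(1) by (auto simp: blinfun.scaleR_left)
    qed simp
    then have "inverse (u f) *\<^sub>R f \<in> blinfun_apply -` V" using X(3) by auto
    then have "u (inverse (u f) *\<^sub>R f) < 1" unfolding V(2)[symmetric] by simp
    then show False using \<open>u f \<noteq> 0\<close> by (simp add: linear_scale[OF u])
  qed
  with X(2) u show ?thesis by (rule evaluation_of_common_kernel)
qed

lemma continuous_map_weak_topology_functional:
  "continuous_map weak_topology euclidean (blinfun_apply (g :: 'a::real_normed_vector \<Rightarrow>\<^sub>L real))"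
proof -
  have "continuous_map weak_topology euclidean
      ((\<lambda>h. h g) \<circ> (\<lambda>x (f :: 'a \<Rightarrow>\<^sub>L real). blinfun_apply f x))"
    unfolding weak_topology_def by (rule continuous_map_pullback) simp
  then show ?thesis by (simp add: o_def)
qed

lemma L_wstar_functional_evaluation:
  assumes "T \<in> L_wstar"
  shows "\<exists>x. \<forall>f. blinfun_apply g (blinfun_apply T f) = blinfun_apply f x"
proof (rule weakstar_continuous_linear_evaluation)
  show "linear (\<lambda>f. blinfun_apply g (blinfun_apply T f))"
    by (intro linearI) (simp_all add: blinfun.add_right blinfun.scaleR_right)
  show "continuous_map weakstar_topology euclidean (\<lambda>f. blinfun_apply g (blinfun_apply T f))"
    using continuous_map_compose[OF _ continuous_map_weak_topology_functional[of g]] assms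
    by (fastforce simp: L_wstar_def o_def)
qed

text \<open>The adjoint \<open>Y\<^sup>* \<rightarrow> X\<close> of a weak-star to weak continuous \<open>T : X\<^sup>* \<rightarrow> Y\<close>; meaningful only on \<^const>\<open>L_wstar\<close>.\<close>

definition preadjoint ::
    "(('a::real_normed_vector \<Rightarrow>\<^sub>L real) \<Rightarrow>\<^sub>L 'b::real_normed_vector) \<Rightarrow> ('b \<Rightarrow>\<^sub>L real) \<Rightarrow> 'a" where
  "preadjoint T g = (SOME x. \<forall>f. blinfun_apply g (blinfun_apply T f) = blinfun_apply f x)"

lemma preadjoint:
  "T \<in> L_wstar \<Longrightarrow> blinfun_apply f (preadjoint T g) = blinfun_apply g (blinfun_apply T f)"
  unfolding preadjoint_def by (rule someI_ex[OF L_wstar_functional_evaluation, THEN spec, symmetric])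

text \<open>The choice by \<open>SOME\<close> is unique because functionals separate points, so
  algebraic identities can be tested on functionals. Membership of the sum is later supplied by the
  subspace \<open>M\<close>.\<close>

lemma preadjoint_add:
  assumes "S \<in> L_wstar" "T \<in> L_wstar" "S + T \<in> L_wstar"
  shows "preadjoint (S + T) g = preadjoint S g + preadjoint T g"
  by (rule functionals_separate_points)
    (simp add: assms preadjoint blinfun.add_right blinfun.add_left)

lemma preadjoint_scaleR:
  assumes "T \<in> L_wstar" "c *\<^sub>R T \<in> L_wstar"
  shows "preadjoint (c *\<^sub>R T) g = c *\<^sub>R preadjoint T g"
  by (rule functionals_separate_points)
    (simp add: assms preadjoint blinfun.scaleR_right blinfun.scaleR_left)

lemma norm_preadjoint_le:
  assumes "T \<in> L_wstar"
  shows "norm (preadjoint T g) \<le> norm g * norm T"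
proof -
  obtain f where f: "norm f \<le> 1" "blinfun_apply f (preadjoint T g) = norm (preadjoint T g)"
    using norming_functional by blast
  have "norm (preadjoint T g) = blinfun_apply g (blinfun_apply T f)"
    using f(2) by (simp add: preadjoint assms)
  also have "\<dots> \<le> norm g * norm (blinfun_apply T f)"
    using norm_blinfun[of g "blinfun_apply T f"] by simp
  also have "\<dots> \<le> norm g * norm T"
    using norm_blinfun[of T f] mult_left_mono[OF f(1), of "norm T"]
    by (intro mult_left_mono) auto
  finally show ?thesis .
qed

lemma L_wstar_eq_K_wstarI:
  assumes "\<And>T :: ('a::real_normed_vector \<Rightarrow>\<^sub>L real) \<Rightarrow>\<^sub>L 'b::banach. T \<in> L_wstar \<Longrightarrow>
    Met_TC.mtotally_bounded (blinfun_apply T ` cball 0 1)"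
  shows "(L_wstar :: (('a \<Rightarrow>\<^sub>L real) \<Rightarrow>\<^sub>L 'b) set) = K_wstar"
  using assms compact_closure_if_totally_bounded by (auto simp: K_wstar_def compact_operator_def)

lemma L_wstar_eq_K_wstar_if_Schur_range:
  assumes "Schur_property TYPE('b::banach)"
  shows "(L_wstar :: (('a::real_normed_vector \<Rightarrow>\<^sub>L real) \<Rightarrow>\<^sub>L 'b) set) = K_wstar"
  by (intro L_wstar_eq_K_wstarI Schur_totally_bounded_image[OF assms] L_wstar_functional_evaluation)

lemma L_wstar_eq_K_wstar_if_Schur_domain:
  assumes "Schur_property TYPE('a::real_normed_vector)"
  shows "(L_wstar :: (('a \<Rightarrow>\<^sub>L real) \<Rightarrow>\<^sub>L 'b::banach) set) = K_wstar"
proof (rule L_wstar_eq_K_wstarI)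
  fix T :: "('a \<Rightarrow>\<^sub>L real) \<Rightarrow>\<^sub>L 'b" assume T: "T \<in> L_wstar"
  \<comment> \<open>The roles are exchanged: a functional \<open>h\<close> composed with
    \<open>preadjoint T\<close> is evaluation at \<open>T h\<close>.\<close>
  have "Met_TC.mtotally_bounded (preadjoint T ` cball 0 1)"
    using preadjoint[OF T] by (intro Schur_totally_bounded_image[OF assms]) blast
  then show "Met_TC.mtotally_bounded (blinfun_apply T ` cball 0 1)"
    by (rule Schauder_totally_bounded[rotated]) (rule preadjoint[OF T])
qed

section \<open>The $p$-Gelfand-Phillips property of operator spaces\<close>

text \<open>Functionals and weak-star null sequences pull back along \<open>A\<close> to
  \<open>M\<close>, so the image sequence is again limited and weakly \<open>p\<close>-summable.
  Linearity is asked only on \<open>M\<close> because \<open>preadjoint\<close> is controlled only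
  on \<open>L_wstar\<close>.\<close>

lemma p_Gelfand_Phillips_image_null:
  fixes A :: "'a::real_normed_vector \<Rightarrow> 'b::real_normed_vector"
  assumes GP: "p_Gelfand_Phillips_on p (UNIV :: 'b set)"
    and lim: "limited_on M (range x)" and sum: "weakly_p_summable_on p M x"
    and add: "\<And>S T. S \<in> M \<Longrightarrow> T \<in> M \<Longrightarrow> A (S + T) = A S + A T"
    and scale: "\<And>c T. T \<in> M \<Longrightarrow> A (c *\<^sub>R T) = c *\<^sub>R A T"
    and bound: "\<And>T. T \<in> M \<Longrightarrow> norm (A T) \<le> C * norm T"
  shows "(\<lambda>n. A (x n)) \<longlonglongrightarrow> 0"
proof -
  have comp: "functional_on M (\<lambda>T. f (A T))" if f: "functional_on UNIV f" for f
  proof -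
    obtain K where K: "\<And>y. \<bar>f y\<bar> \<le> K * norm y" using f by (auto simp: functional_on_def)
    have "\<bar>f (A T)\<bar> \<le> (\<bar>K\<bar> * C) * norm T" if "T \<in> M" for T
    proof -
      have "\<bar>f (A T)\<bar> \<le> \<bar>K\<bar> * norm (A T)"
        using K[of "A T"] mult_right_mono[OF abs_ge_self[of K], of "norm (A T)"] by simp
      also have "\<dots> \<le> \<bar>K\<bar> * (C * norm T)" using bound[OF that] by (rule mult_left_mono) simp
      finally show ?thesis by (simp add: mult.assoc)
    qed
    then show ?thesis using f by (auto simp: functional_on_def add scale)
  qed
  have xM: "x n \<in> M" for n using lim by (auto simp: limited_on_def)
  have "limited_on UNIV (range (\<lambda>n. A (x n)))"
    unfolding limited_on_def
  proof (intro conjI allI impI)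
    obtain B where "\<And>n. norm (x n) \<le> B"
      using lim by (auto simp: limited_on_def bounded_iff)
    then have "norm (A (x n)) \<le> \<bar>C\<bar> * B" for n
      using bound[OF xM[of n]] mult_right_mono[OF abs_ge_self[of C], of "norm (x n)"]
        mult_left_mono[of "norm (x n)" B "\<bar>C\<bar>"] by fastforce
    then show "bounded (range (\<lambda>n. A (x n)))" by (auto simp: bounded_iff)
  next
    fix f assume "weakstar_null_on (UNIV :: 'b set) f"
    then have "weakstar_null_on M (\<lambda>n T. f n (A T))"
      by (auto simp: weakstar_null_on_def comp)
    then have "(\<lambda>n. SUP T\<in>range x. ennreal \<bar>f n (A T)\<bar>) \<longlonglongrightarrow> 0"
      using lim unfolding limited_on_def by blast
    then show "(\<lambda>n. SUP y\<in>range (\<lambda>n. A (x n)). ennreal \<bar>f n y\<bar>) \<longlonglongrightarrow> 0"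
      by (simp add: image_image)
  qed auto
  moreover have "weakly_p_summable_on p UNIV (\<lambda>n. A (x n))"
    using sum comp by (auto simp: weakly_p_summable_on_def)
  ultimately show ?thesis using GP unfolding p_Gelfand_Phillips_on_def by blast
qed

lemma blinfun_apply_bounded_tendsto_zero:
  fixes f :: "nat \<Rightarrow> 'a::real_normed_vector \<Rightarrow>\<^sub>L 'b::real_normed_vector"
  assumes "f \<longlonglongrightarrow> 0" "\<And>n. norm (x n) \<le> 1"
  shows "(\<lambda>n. blinfun_apply (f n) (x n)) \<longlonglongrightarrow> 0"
proof (rule Lim_null_comparison)
  show "\<forall>\<^sub>F n in sequentially. norm (blinfun_apply (f n) (x n)) \<le> norm (f n)"
    using norm_blinfun mult_left_mono[OF assms(2) norm_ge_zero] order_trans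
    by (fastforce intro!: always_eventually)
  show "(\<lambda>n. norm (f n)) \<longlonglongrightarrow> 0" using assms(1) by (rule tendsto_norm_zero)
qed

text \<open>The test sequence may depend on \<open>T\<close>, so the n-th vector is chosen to norm
  \<open>T n\<close> up to the factor 2.\<close>

lemma tendsto_zero_if_almost_norming:
  fixes T :: "nat \<Rightarrow> 'a::real_normed_vector \<Rightarrow>\<^sub>L 'b::real_normed_vector"
  assumes "\<And>x. (\<And>n. norm (x n) \<le> 1) \<Longrightarrow> (\<lambda>n. blinfun_apply (T n) (x n)) \<longlonglongrightarrow> 0"
  shows "T \<longlonglongrightarrow> 0"
proof -
  have "\<exists>x. norm x \<le> 1 \<and> norm (T n) \<le> 2 * norm (blinfun_apply (T n) x)" for n
    using blinfun_almost_norming[of "T n"] by blast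
  then obtain x where x: "\<And>n. norm (x n) \<le> 1"
    "\<And>n. norm (T n) \<le> 2 * norm (blinfun_apply (T n) (x n))" by metis
  have "(\<lambda>n. 2 * norm (blinfun_apply (T n) (x n))) \<longlonglongrightarrow> 0"
    using tendsto_mult_left[OF tendsto_norm_zero[OF assms[OF x(1)]], of 2] by simp
  with always_eventually[OF allI[OF x(2)]] show ?thesis by (rule Lim_null_comparison)
qed

lemma p_Gelfand_Phillips_operators:
  fixes M :: "('x::real_normed_vector \<Rightarrow>\<^sub>L 'y::real_normed_vector) set"
  assumes GP: "p_Gelfand_Phillips_on p (UNIV :: ('x \<Rightarrow>\<^sub>L real) set)"
    and Schur: "Schur_property TYPE('y)"
  shows "p_Gelfand_Phillips_on p M"
  unfolding p_Gelfand_Phillips_on_def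
proof (intro allI impI, elim conjE)
  fix T assume T: "limited_on M (range T)" "weakly_p_summable_on p M T"
  have adj: "(\<lambda>n. g o\<^sub>L T n) \<longlonglongrightarrow> 0" for g :: "'y \<Rightarrow>\<^sub>L real"
  proof (rule p_Gelfand_Phillips_image_null[OF GP T])
    show "norm (g o\<^sub>L U) \<le> norm g * norm U" for U by (rule norm_blinfun_compose)
  qed (auto intro: blinfun_eqI simp: blinfun.add_left blinfun.add_right blinfun.scaleR_left
      blinfun.scaleR_right)
  show "T \<longlonglongrightarrow> 0"
  proof (rule tendsto_zero_if_almost_norming, rule Schur_weakly_null_imp_null[OF Schur])
    fix x :: "nat \<Rightarrow> 'x" and g :: "'y \<Rightarrow>\<^sub>L real" assume "\<And>n. norm (x n) \<le> 1"
    with adj[of g] have "(\<lambda>n. blinfun_apply (g o\<^sub>L T n) (x n)) \<longlonglongrightarrow> 0"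
      by (rule blinfun_apply_bounded_tendsto_zero)
    then show "(\<lambda>n. blinfun_apply g (blinfun_apply (T n) (x n))) \<longlonglongrightarrow> 0" by simp
  qed
qed

lemma p_Gelfand_Phillips_L_wstar_Schur_range:
  fixes M :: "(('x::real_normed_vector \<Rightarrow>\<^sub>L real) \<Rightarrow>\<^sub>L 'y::real_normed_vector) set"
  assumes GP: "p_Gelfand_Phillips_on p (UNIV :: 'x set)"
    and Schur: "Schur_property TYPE('y)"
    and M: "subspace M" "M \<subseteq> L_wstar"
  shows "p_Gelfand_Phillips_on p M"
  unfolding p_Gelfand_Phillips_on_def
proof (intro allI impI, elim conjE)
  fix T assume T: "limited_on M (range T)" "weakly_p_summable_on p M T"
  then have TL: "T n \<in> L_wstar" for n using M(2) by (auto simp: limited_on_def)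
  have adj: "(\<lambda>n. preadjoint (T n) g) \<longlonglongrightarrow> 0" for g
    by (rule p_Gelfand_Phillips_image_null[OF GP T, where C = "norm g"])
      (use M subspace_add[OF M(1)] subspace_scale[OF M(1)] in
        \<open>auto intro!: preadjoint_add preadjoint_scaleR norm_preadjoint_le\<close>)
  show "T \<longlonglongrightarrow> 0"
  proof (rule tendsto_zero_if_almost_norming, rule Schur_weakly_null_imp_null[OF Schur])
    fix f :: "nat \<Rightarrow> 'x \<Rightarrow>\<^sub>L real" and g :: "'y \<Rightarrow>\<^sub>L real" assume f: "\<And>n. norm (f n) \<le> 1"
    \<comment> \<open>Moving \<open>T n\<close> to the other side leaves a fixed null sequence in
      \<open>'x\<close>, tested by functionals from the unit ball.\<close>
    have "norm (blinfun_apply g (blinfun_apply (T n) (f n))) \<le> norm (preadjoint (T n) g)" for n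
      using norm_blinfun[of "f n" "preadjoint (T n) g"]
        mult_right_mono[OF f[of n], of "norm (preadjoint (T n) g)"]
      by (simp add: preadjoint[OF TL])
    from always_eventually[OF allI[OF this]] tendsto_norm_zero[OF adj[of g]]
    show "(\<lambda>n. blinfun_apply g (blinfun_apply (T n) (f n))) \<longlonglongrightarrow> 0"
      by (rule Lim_null_comparison)
  qed
qed

text \<open>Evaluation at a fixed functional maps \<open>M\<close> into the Gelfand-Phillips space
  and gives pointwise convergence. The Schur property makes this uniform when applied to
  \<open>preadjoint (T n) (g n)\<close> with varying \<open>g n\<close>.\<close>

lemma p_Gelfand_Phillips_L_wstar_Schur_domain:
  fixes M :: "(('x::real_normed_vector \<Rightarrow>\<^sub>L real) \<Rightarrow>\<^sub>L 'y::real_normed_vector) set"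
  assumes GP: "p_Gelfand_Phillips_on p (UNIV :: 'y set)"
    and Schur: "Schur_property TYPE('x)"
    and M: "M \<subseteq> L_wstar"
  shows "p_Gelfand_Phillips_on p M"
  unfolding p_Gelfand_Phillips_on_def
proof (intro allI impI, elim conjE)
  fix T assume T: "limited_on M (range T)" "weakly_p_summable_on p M T"
  then have TL: "T n \<in> L_wstar" for n using M by (auto simp: limited_on_def)
  have eval: "(\<lambda>n. blinfun_apply (T n) f) \<longlonglongrightarrow> 0" for f
  proof (rule p_Gelfand_Phillips_image_null[OF GP T])
    show "norm (blinfun_apply U f) \<le> norm f * norm U" for U
      using norm_blinfun[of U f] by (simp add: mult.commute)
  qed (auto simp: blinfun.add_left blinfun.scaleR_left)
  show "T \<longlonglongrightarrow> 0"
  proof (rule tendsto_zero_if_almost_norming)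
    fix f :: "nat \<Rightarrow> 'x \<Rightarrow>\<^sub>L real" assume f: "\<And>n. norm (f n) \<le> 1"
    have "\<exists>g :: 'y \<Rightarrow>\<^sub>L real. norm g \<le> 1 \<and>
        blinfun_apply g (blinfun_apply (T n) (f n)) = norm (blinfun_apply (T n) (f n))" for n
      using norming_functional by blast
    then obtain g :: "nat \<Rightarrow> 'y \<Rightarrow>\<^sub>L real" where g: "\<And>n. norm (g n) \<le> 1"
      "\<And>n. blinfun_apply (g n) (blinfun_apply (T n) (f n)) = norm (blinfun_apply (T n) (f n))"
      by metis
    have null: "(\<lambda>n. preadjoint (T n) (g n)) \<longlonglongrightarrow> 0"
    proof (rule Schur_weakly_null_imp_null[OF Schur])
      fix h :: "'x \<Rightarrow>\<^sub>L real"
      \<comment> \<open>Here \<open>h\<close> at the preadjoint is \<open>g n\<close> at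
        \<open>T n h\<close>, and all \<open>g n\<close> lie in the dual ball, so evaluation at
        \<open>h\<close> dominates.\<close>
      have "norm (blinfun_apply h (preadjoint (T n) (g n))) \<le> norm (blinfun_apply (T n) h)" for n
        using norm_blinfun[of "g n" "blinfun_apply (T n) h"]
          mult_right_mono[OF g(1)[of n], of "norm (blinfun_apply (T n) h)"]
        by (simp add: preadjoint[OF TL])
      from always_eventually[OF allI[OF this]] tendsto_norm_zero[OF eval[of h]]
      show "(\<lambda>n. blinfun_apply h (preadjoint (T n) (g n))) \<longlonglongrightarrow> 0"
        by (rule Lim_null_comparison)
    qed
    have "norm (blinfun_apply (T n) (f n)) \<le> norm (preadjoint (T n) (g n))" for n
      using norm_blinfun[of "f n" "preadjoint (T n) (g n)"]
        mult_right_mono[OF f[of n], of "norm (preadjoint (T n) (g n))"]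
      by (simp add: preadjoint[OF TL] g(2))
    from always_eventually[OF allI[OF this]] tendsto_norm_zero[OF null]
    show "(\<lambda>n. blinfun_apply (T n) (f n)) \<longlonglongrightarrow> 0"
      by (rule Lim_null_comparison)
  qed
qed

theorem corollary10:
  fixes p :: real
  assumes "1 \<le> p"
  shows
    "(p_Gelfand_Phillips_on p (UNIV :: ('x::banach \<Rightarrow>\<^sub>L real) set) \<and>
        Schur_property TYPE('y::banach) \<longrightarrow>
        (\<forall>M :: ('x \<Rightarrow>\<^sub>L 'y) set. subspace M \<and> closed M \<longrightarrow> p_Gelfand_Phillips_on p M)) \<and>
     (p_Gelfand_Phillips_on p (UNIV :: 'x set) \<and> Schur_property TYPE('y) \<longrightarrow>
        (L_wstar :: (('x \<Rightarrow>\<^sub>L real) \<Rightarrow>\<^sub>L 'y) set) = K_wstar \<and>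
        (\<forall>M. subspace M \<and> closedin (top_of_set (L_wstar :: (('x \<Rightarrow>\<^sub>L real) \<Rightarrow>\<^sub>L 'y) set)) M
              \<longrightarrow> p_Gelfand_Phillips_on p M)) \<and>
     (p_Gelfand_Phillips_on p (UNIV :: 'y set) \<and> Schur_property TYPE('x) \<longrightarrow>
        (L_wstar :: (('x \<Rightarrow>\<^sub>L real) \<Rightarrow>\<^sub>L 'y) set) = K_wstar \<and>
        (\<forall>M. subspace M \<and> closedin (top_of_set (L_wstar :: (('x \<Rightarrow>\<^sub>L real) \<Rightarrow>\<^sub>L 'y) set)) M
              \<longrightarrow> p_Gelfand_Phillips_on p M))"
  \<comment> \<open>Relative closedness supplies the inclusion of \<open>M\<close> in
    \<open>L_wstar\<close> through \<open>closedin_subset\<close>.\<close>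
  using p_Gelfand_Phillips_operators[of p, where 'x = 'x and 'y = 'y]
    p_Gelfand_Phillips_L_wstar_Schur_range[of p, where 'x = 'x and 'y = 'y]
    p_Gelfand_Phillips_L_wstar_Schur_domain[of p, where 'x = 'x and 'y = 'y]
    L_wstar_eq_K_wstar_if_Schur_range[where 'a = 'x and 'b = 'y]
    L_wstar_eq_K_wstar_if_Schur_domain[where 'a = 'x and 'b = 'y]
    closedin_subset[of "top_of_set (L_wstar :: (('x \<Rightarrow>\<^sub>L real) \<Rightarrow>\<^sub>L 'y) set)"]
  by auto

end
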